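(* Let $\mathcal{G}$ be a finite simple graph with $|e(\mathcal{G})|$ edges and first Zagreb index $M_1(\mathcal{G})$. Then \[ LE_{CN}(\mathcal{G})\le E_{CN}(\mathcal{G})+2\big(M_1(\mathcal{G})-2|e(\mathcal{G})|\big)\quad\text{and}\quad LE^+_{CN}(\mathcal{G})\le E_{CN}(\mathcal{G})+2\big(M_1(\mathcal{G})-2|e(\mathcal{G})|\big). \]
   Context: Let $V(\mathcal{G})=\{v_1,\dots,v_p\}$, $d(v)$ the degree, $M_1(\mathcal{G})=\sum_i d(v_i)^2$. $\mathrm{CN}(\mathcal{G})$ has $(i,j)$-entry $|N(v_i)\cap N(v_j)|$ for $i\neq j$ (open neighbourhoods) and $0$ on the diagonal; $E_{CN}(\mathcal{G})$ is the sum of absolute values of its eigenvalues. $\mathrm{CNRS}(\mathcal{G})$ is the diagonal matrix of row sums of $\mathrm{CN}(\mathcal{G})$; $\mathrm{CNL}=\mathrm{CNRS}-\mathrm{CN}$, $\mathrm{CNSL}=\mathrm{CNRS}+\mathrm{CN}$. $LE_{CN}(\mathcal{G})=\sum_\nu|\nu-tr(\mathrm{CNRS}(\mathcal{G}))/p|$ over eigenvalues $\nu$ of $\mathrm{CNL}(\mathcal{G})$ with multiplicity; $LE^+_{CN}(\mathcal{G})$ likewise with $\mathrm{CNSL}(\mathcal{G})$. *)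

theory Defs
  imports Complex_Main "Jordan_Normal_Form.Char_Poly"
    "HOL-Computational_Algebra.Fundamental_Theorem_Algebra"
begin

definition finite_simple_graph :: "'a set \<Rightarrow> 'a set set \<Rightarrow> bool" where
  "finite_simple_graph V E \<longleftrightarrow> finite V \<and> (\<forall>e\<in>E. e \<subseteq> V \<and> card e = 2)"

definition nbhd :: "'a set set \<Rightarrow> 'a \<Rightarrow> 'a set" where
  "nbhd E v = {u. {u, v} \<in> E}"

definition degree_of :: "'a set set \<Rightarrow> 'a \<Rightarrow> nat" where
  "degree_of E v = card (nbhd E v)"

definition first_zagreb :: "'a set \<Rightarrow> 'a set set \<Rightarrow> nat" where
  "first_zagreb V E = (\<Sum>v\<in>V. (degree_of E v)\<^sup>2)"

text \<open>The matrices are taken with respect to an enumeration \<open>vs\<close> (without repetitions) of the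
  vertex set; the vertex \<open>v\<^sub>i\<close> is \<open>vs ! (i - 1)\<close>.\<close>

definition CN :: "'a set set \<Rightarrow> 'a list \<Rightarrow> real mat" where
  "CN E vs = mat (length vs) (length vs)
     (\<lambda>(i, j). if i = j then 0 else real (card (nbhd E (vs ! i) \<inter> nbhd E (vs ! j))))"

definition CNRS :: "'a set set \<Rightarrow> 'a list \<Rightarrow> real mat" where
  "CNRS E vs = mat_diag (length vs) (\<lambda>i. \<Sum>j<length vs. CN E vs $$ (i, j))"

definition CNL :: "'a set set \<Rightarrow> 'a list \<Rightarrow> real mat" where
  "CNL E vs = CNRS E vs - CN E vs"

definition CNSL :: "'a set set \<Rightarrow> 'a list \<Rightarrow> real mat" where
  "CNSL E vs = CNRS E vs + CN E vs"

text \<open>The eigenvalues, with algebraic multiplicity, of a real matrix. The multiset is formed over the complex numbers, so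
  that it is complete for every square matrix without appeal to the spectral theorem; for the
  symmetric matrices above all its elements are real, and \<open>cmod\<close> below is the absolute value.\<close>

definition eigenvalue_mset :: "real mat \<Rightarrow> complex multiset" where
  "eigenvalue_mset A = proots (char_poly (map_mat complex_of_real A))"

lemma size_eigenvalue_mset:
  assumes "A \<in> carrier_mat n n"
  shows "size (eigenvalue_mset A) = n"
proof -
  have c: "map_mat complex_of_real A \<in> carrier_mat n n"
    using assms by simp
  show ?thesis
    using degree_monic_char_poly[OF c]
    by (simp add: eigenvalue_mset_def size_proots_complex)
qed

lemma set_eigenvalue_mset:
  assumes "A \<in> carrier_mat n n"
  shows "set_mset (eigenvalue_mset A) = {\<nu>. eigenvalue (map_mat complex_of_real A) \<nu>}"
proof -
  have c: "map_mat complex_of_real A \<in> carrier_mat n n"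
    using assms by simp
  have "char_poly (map_mat complex_of_real A) \<noteq> 0"
    using degree_monic_char_poly[OF c] by auto
  then show ?thesis
    by (simp add: eigenvalue_mset_def eigenvalue_root_char_poly[OF c])
qed

definition mat_tr :: "real mat \<Rightarrow> real" where
  "mat_tr A = sum_list (diag_mat A)"

definition E_CN :: "'a set set \<Rightarrow> 'a list \<Rightarrow> real" where
  "E_CN E vs = (\<Sum>\<nu>\<in>#eigenvalue_mset (CN E vs). cmod \<nu>)"

definition LE_CN :: "'a set set \<Rightarrow> 'a list \<Rightarrow> real" where
  "LE_CN E vs = (\<Sum>\<nu>\<in>#eigenvalue_mset (CNL E vs).
     cmod (\<nu> - complex_of_real (mat_tr (CNRS E vs) / real (length vs))))"

definition LE_CN_plus :: "'a set set \<Rightarrow> 'a list \<Rightarrow> real" where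
  "LE_CN_plus E vs = (\<Sum>\<nu>\<in>#eigenvalue_mset (CNSL E vs).
     cmod (\<nu> - complex_of_real (mat_tr (CNRS E vs) / real (length vs))))"

end

theory Submission
  imports Defs "Jordan_Normal_Form.Schur_Decomposition"
begin

text \<open>
  Both \<open>CNL\<close> and \<open>CNSL\<close> are the diagonal matrix \<open>CNRS\<close> plus \<open>\<plusminus> CN\<close>, so the inequality is the
  triangle inequality for the trace norm, applied after shifting by the mean \<open>t\<close> of the row sums
  \<open>r i\<close>. It follows from the spectral theorem: in a unitary eigenbasis of the sum, the eigenvalues
  are diagonal entries, and for a Hermitian \<open>A\<close> the absolute values of the diagonal entries in any
  unitary basis add up to at most the sum of the absolute values of the eigenvalues of \<open>A\<close>. The
  diagonal part contributes \<open>\<Sum>i. \<bar>r i - t\<bar>\<close>, which is at most twice the total of the nonnegative row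
  sums; counting pairs of neighbours of each vertex shows that this total is \<open>M\<^sub>1 - 2\<bar>e\<bar>\<close>.
\<close>

subsection \<open>Unitary diagonalisation of Hermitian matrices\<close>

lemma dim_mat_adjoint [simp]:
  "dim_row (mat_adjoint A) = dim_col A" "dim_col (mat_adjoint A) = dim_row A"
  by (auto simp: mat_adjoint_def)

lemma mat_adjoint_carrier [simp]:
  "A \<in> carrier_mat m n \<Longrightarrow> mat_adjoint A \<in> carrier_mat n m"
  by (metis carrier_matD carrier_matI dim_mat_adjoint)

lemma index_mat_adjoint [simp]:
  "i < dim_col A \<Longrightarrow> j < dim_row A \<Longrightarrow> mat_adjoint A $$ (i, j) = conjugate (A $$ (j, i))"
  by (simp add: mat_adjoint_def mat_of_rows_def)

lemma mat_adjoint_adjoint [simp]: "mat_adjoint (mat_adjoint A) = A"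
  by (rule eq_matI) auto

lemma mat_adjoint_one [simp]: "mat_adjoint (1\<^sub>m n :: complex mat) = 1\<^sub>m n"
  by (rule eq_matI) auto

lemma mat_adjoint_mult:
  fixes A B :: "complex mat"
  assumes "A \<in> carrier_mat m n" "B \<in> carrier_mat n k"
  shows "mat_adjoint (A * B) = mat_adjoint B * mat_adjoint A"
  using assms by (intro eq_matI) (auto simp: scalar_prod_def mult.commute)

lemma mat_adjoint_four_block_diag:
  fixes A D :: "complex mat"
  assumes "A \<in> carrier_mat m m" "D \<in> carrier_mat n n"
  shows "mat_adjoint (four_block_mat A (0\<^sub>m m n) (0\<^sub>m n m) D)
    = four_block_mat (mat_adjoint A) (0\<^sub>m m n) (0\<^sub>m n m) (mat_adjoint D)"
  using assms by (intro eq_matI) auto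

text \<open>Only the left inverse is demanded. The matrix is square, so it is a right inverse as
  well, which \<open>unitary_matD\<close> records.\<close>

definition unitary_mat :: "nat \<Rightarrow> complex mat \<Rightarrow> bool" where
  "unitary_mat n U \<longleftrightarrow> U \<in> carrier_mat n n \<and> mat_adjoint U * U = 1\<^sub>m n"

lemma unitary_matD:
  assumes "unitary_mat n U"
  shows "U \<in> carrier_mat n n" "mat_adjoint U \<in> carrier_mat n n"
    "mat_adjoint U * U = 1\<^sub>m n" "U * mat_adjoint U = 1\<^sub>m n"
proof -
  show U: "U \<in> carrier_mat n n" and inv: "mat_adjoint U * U = 1\<^sub>m n"
    using assms by (simp_all add: unitary_mat_def)
  then show "mat_adjoint U \<in> carrier_mat n n"
    by simp
  from mat_mult_left_right_inverse[OF this U inv] show "U * mat_adjoint U = 1\<^sub>m n" .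
qed

lemma unitary_mat_one: "unitary_mat n (1\<^sub>m n)"
  by (simp add: unitary_mat_def)

lemma unitary_mat_mult:
  assumes "unitary_mat n U" "unitary_mat n W"
  shows "unitary_mat n (U * W)"
proof -
  note u = unitary_matD[OF assms(1)] and w = unitary_matD[OF assms(2)]
  have "mat_adjoint (U * W) * (U * W) = mat_adjoint W * ((mat_adjoint U * U) * W)"
    using u(1,2) w(1,2) by (simp add: mat_adjoint_mult[of _ n n _ n] assoc_mult_mat[of _ n n _ n _ n]
        mult_carrier_mat[of _ n n _ n])
  also have "\<dots> = 1\<^sub>m n"
    using u w by simp
  finally show ?thesis
    using u w by (simp add: unitary_mat_def)
qed

lemma unitary_mat_adjoint: "unitary_mat n U \<Longrightarrow> unitary_mat n (mat_adjoint U)"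
  by (simp add: unitary_matD unitary_mat_def[of n "mat_adjoint U"])

text \<open>Extends a diagonalisation of the trailing block to the whole matrix in the induction for
  \<open>hermitian_unitary_diag\<close>.\<close>

lemma unitary_mat_four_block:
  assumes "unitary_mat n U"
  shows "unitary_mat (1 + n) (four_block_mat (1\<^sub>m 1) (0\<^sub>m 1 n) (0\<^sub>m n 1) U)"
proof -
  note u = unitary_matD[OF assms]
  let ?F = "four_block_mat (1\<^sub>m 1) (0\<^sub>m 1 n) (0\<^sub>m n 1)"
  have "mat_adjoint (?F U) * ?F U = ?F (mat_adjoint U) * ?F U"
    using u by (simp add: mat_adjoint_four_block_diag)
  also have "\<dots> = ?F (mat_adjoint U * U)"
    using u(1,2) by (subst mult_four_block_mat[of _ 1 1 _ n _ n _ _ 1 _ n]) auto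
  also have "\<dots> = 1\<^sub>m (1 + n)"
    unfolding u(3) by (rule eq_matI) auto
  finally show ?thesis
    using four_block_carrier_mat[of "1\<^sub>m 1" 1 1 U n n] u(1) by (simp add: unitary_mat_def)
qed

lemma of_real_cmod_square: "(complex_of_real (cmod z))\<^sup>2 = z * cnj z"
  using complex_norm_square[of z] by simp

text \<open>An eigenvector is completed to a basis and orthogonalised by Gram-Schmidt, which leaves
  the first vector unchanged. Scaling the results to unit length gives the columns of
  \<open>W\<close>, and a scaled eigenvector is still an eigenvector.\<close>

lemma exists_unitary_eigen_col:
  fixes A :: "complex mat"
  assumes A: "A \<in> carrier_mat n n" and e: "eigenvalue A e"
  obtains W where "unitary_mat n W" "0 < n" "A *\<^sub>v col W 0 = e \<cdot>\<^sub>v col W 0"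
proof -
  obtain v where v: "v \<in> carrier_vec n" "v \<noteq> 0\<^sub>v n" and ev: "A *\<^sub>v v = e \<cdot>\<^sub>v v"
    using e A by (auto simp: eigenvalue_def eigenvector_def)
  define b where "b = basis_completion v"
  define ws where "ws = gram_schmidt n b"
  interpret cof_vec_space n "TYPE(complex)" .
  from basis_completion[OF v, folded b_def]
  have dist_b: "distinct b" and indep: "\<not> lin_dep (set b)"
    and b: "set b \<subseteq> carrier_vec n" and hdb: "hd b = v" and len_b: "length b = n"
    by auto
  have n: "0 < n"
    using v by (cases n) auto
  then obtain vs where bv: "b = v # vs"
    using hdb len_b by (cases b) auto
  from gram_schmidt_result[OF b dist_b indep refl, folded ws_def]
  have ws: "set ws \<subseteq> carrier_vec n" "corthogonal ws" "length ws = n"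
    by (auto simp: len_b)
  have ws0: "ws ! 0 = v"
    using gram_schmidt_hd[OF v(1), of vs, folded bv] ws(3) n
    by (metis hd_conv_nth length_greater_0_conv ws_def)
  have wsc: "ws ! j \<in> carrier_vec n" if "j < n" for j
    using ws that by auto
  \<comment> \<open>\<open>c j\<close> is the reciprocal of the norm of \<open>ws ! j\<close>. The
    vectors \<open>ws\<close> are nonzero and pairwise orthogonal, but they need not have unit
    length.\<close>
  define c where "c j = complex_of_real (1 / sqrt (\<Sum>i<n. (cmod (ws ! j $ i))\<^sup>2))" for j
  have sq: "ws ! j \<bullet>c ws ! j = complex_of_real (\<Sum>i<n. (cmod (ws ! j $ i))\<^sup>2)" if "j < n" for j
    using wsc[OF that] by (simp add: scalar_prod_def of_real_cmod_square lessThan_atLeast0)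
  have c_norm: "cnj (c j) * c j * (ws ! j \<bullet>c ws ! j) = 1" if j: "j < n" for j
  proof -
    define s where "s = (\<Sum>i<n. (cmod (ws ! j $ i))\<^sup>2)"
    have "s \<noteq> 0"
      using corthogonalD[OF ws(2), of j j] sq[OF j] j ws(3)
      unfolding s_def by (metis of_real_0)
    moreover have "s \<ge> 0"
      by (auto simp: s_def intro: sum_nonneg)
    ultimately have "1 / sqrt s * (1 / sqrt s) * s = 1"
      by simp
    then show ?thesis
      unfolding sq[OF j] c_def s_def[symmetric] complex_cnj_complex_of_real
      by (metis of_real_1 of_real_mult)
  qed
  define W where "W = mat n n (\<lambda>(i, j). c j * ws ! j $ i)"
  have W: "W \<in> carrier_mat n n"
    by (simp add: W_def)
  have "mat_adjoint W * W = 1\<^sub>m n"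
  proof (rule eq_matI)
    fix i j
    assume "i < dim_row (1\<^sub>m n :: complex mat)" "j < dim_col (1\<^sub>m n :: complex mat)"
    then have ij: "i < n" "j < n" by auto
    have "(mat_adjoint W * W) $$ (i, j) = cnj (c i) * c j * (ws ! j \<bullet>c ws ! i)"
      using W ij wsc[OF ij(1)] wsc[OF ij(2)]
      by (simp add: scalar_prod_def W_def sum_distrib_left mult_ac)
    also have "\<dots> = (if i = j then 1 else 0)"
      using c_norm[OF ij(1)] corthogonalD[OF ws(2), of j i] ij ws(3) by auto
    finally show "(mat_adjoint W * W) $$ (i, j) = 1\<^sub>m n $$ (i, j)"
      using ij by simp
  qed (use W in auto)
  then have un: "unitary_mat n W"
    using W by (simp add: unitary_mat_def)
  have "col W 0 = c 0 \<cdot>\<^sub>v v"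
    using n v by (intro eq_vecI) (auto simp: W_def ws0)
  then have "A *\<^sub>v col W 0 = e \<cdot>\<^sub>v col W 0"
    using A v ev by (simp add: mult_mat_vec[of A n n] smult_smult_assoc mult.commute)
  then show ?thesis
    using that un n by blast
qed

lemma hermitian_conj:
  fixes A :: "complex mat"
  assumes "A \<in> carrier_mat n n" "mat_adjoint A = A" "W \<in> carrier_mat n n"
  shows "mat_adjoint (mat_adjoint W * A * W) = mat_adjoint W * A * W"
  using assms by (simp add: mat_adjoint_mult[of _ n n _ n] assoc_mult_mat[of _ n n _ n _ n]
        mult_carrier_mat[of _ n n _ n])

lemma char_poly_unitary_conj:
  assumes A: "A \<in> carrier_mat n n" and W: "unitary_mat n W"
  shows "char_poly (mat_adjoint W * A * W) = char_poly A"
proof (rule char_poly_similar, unfold similar_mat_def, intro exI)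
  show "similar_mat_wit (mat_adjoint W * A * W) A (mat_adjoint W) W"
    using A unitary_matD[OF W] by (intro similar_mat_witI[of _ _ n]) auto
qed

text \<open>Deflation by induction on the list of roots. Conjugating by a unitary matrix whose first
  column is an eigenvector for \<open>e\<close> clears the rest of the first column, and by
  Hermitian symmetry the rest of the first row. The remaining block is again Hermitian and has the
  roots \<open>es\<close>. The diagonal thus appears in the order of the given list.\<close>

lemma hermitian_unitary_diag:
  fixes A :: "complex mat"
  assumes "A \<in> carrier_mat n n" "mat_adjoint A = A"
    and "char_poly A = (\<Prod>e\<leftarrow>es. [:- e, 1:])"
  shows "\<exists>U. unitary_mat n U \<and> mat_adjoint U * A * U = mat_diag n (\<lambda>i. es ! i)"
  using assms
proof (induction es arbitrary: n A)
  case Nil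
  then have "n = 0"
    using degree_monic_char_poly[of A n] by auto
  then show ?case
    using Nil unitary_mat_one[of n] by (intro exI[of _ "1\<^sub>m n"]) (auto simp: mat_diag_def)
next
  case (Cons e es)
  note A = Cons.prems(1)
  have e: "eigenvalue A e"
    using Cons.prems by (simp add: eigenvalue_root_char_poly[OF A])
  obtain W where W: "unitary_mat n W" and n: "0 < n"
    and ev: "A *\<^sub>v col W 0 = e \<cdot>\<^sub>v col W 0"
    using exists_unitary_eigen_col[OF A e] .
  note w = unitary_matD[OF W]
  define m where "m = n - 1"
  have nm: "n = 1 + m"
    using n by (simp add: m_def)
  define B where "B = mat_adjoint W * A * W"
  have B: "B \<in> carrier_mat n n"
    using A w(1) by (simp add: B_def mult_carrier_mat[of _ n n _ n])
  have B_adj: "mat_adjoint B = B"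
    unfolding B_def using A Cons.prems(2) w(1) by (rule hermitian_conj)
  \<comment> \<open>The first column of \<open>B\<close> is \<open>e\<close> times the first column
    of \<open>mat_adjoint W * W\<close>, which is the identity.\<close>
  have B_col: "B $$ (i, 0) = (if i = 0 then e else 0)" if i: "i < n" for i
  proof -
    have "B $$ (i, 0) = row (mat_adjoint W) i \<bullet> (A *\<^sub>v col W 0)"
    proof -
      have "B $$ (i, 0) = (mat_adjoint W * (A * W)) $$ (i, 0)"
        using A w(1,2) by (simp add: B_def assoc_mult_mat[of _ n n _ n _ n])
      also have "\<dots> = row (mat_adjoint W) i \<bullet> col (A * W) 0"
        using A w(1) i n by (intro index_mult_mat(1)) auto
      finally show ?thesis
        by (simp only: col_mult2[OF A w(1) n])
    qed
    also have "\<dots> = e * (mat_adjoint W * W) $$ (i, 0)"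
      unfolding ev using w(1,2) i n by simp
    finally show ?thesis
      using w(3) i n by simp
  qed
  \<comment> \<open>Since \<open>B\<close> equals its adjoint, the zeros below the corner also occur
    to the right of it.\<close>
  have B_row: "B $$ (0, i) = (if i = 0 then e else 0)" if i: "i < n" for i
  proof (cases "i = 0")
    case False
    have "B $$ (0, i) = mat_adjoint B $$ (0, i)"
      by (simp add: B_adj)
    also have "\<dots> = cnj (B $$ (i, 0))"
      using B n i by simp
    finally show ?thesis
      using B_col[OF i] False by simp
  qed (use B_col[OF n] in simp)
  define C where "C = mat m m (\<lambda>(i, j). B $$ (Suc i, Suc j))"
  have C: "C \<in> carrier_mat m m"
    by (simp add: C_def)
  have B_swap: "cnj (B $$ (i, j)) = B $$ (j, i)" if "i < n" "j < n" for i j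
    using arg_cong[OF B_adj, of "\<lambda>M. M $$ (j, i)"] B that by simp
  have C_adj: "mat_adjoint C = C"
    by (intro eq_matI) (auto simp: C_def nm B_swap)
  let ?F = "\<lambda>X. four_block_mat X (0\<^sub>m 1 m) (0\<^sub>m m 1)"
  let ?e = "mat 1 1 (\<lambda>_. e)"
  have B_block: "B = ?F ?e C"
    using B C B_col B_row by (intro eq_matI) (auto simp: nm C_def)
  \<comment> \<open>The characteristic polynomial of a block diagonal matrix factors. Cancelling
    \<open>[:- e, 1:]\<close> leaves for \<open>C\<close> exactly the product over \<open>es\<close>
    that the induction hypothesis asks for.\<close>
  have "char_poly B = char_poly ?e * char_poly C"
    unfolding B_block using C by (intro char_poly_four_block_zeros_col) auto
  then have "char_poly A = char_poly ?e * char_poly C"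
    using char_poly_unitary_conj[OF A W] by (simp only: B_def)
  moreover have "char_poly ?e = [:- e, 1:]"
    by (simp add: char_poly_defs det_def sign_def)
  ultimately have "[:- e, 1:] * char_poly C = [:- e, 1:] * (\<Prod>e\<leftarrow>es. [:- e, 1:])"
    using Cons.prems(3) by simp
  then have "char_poly C = (\<Prod>e\<leftarrow>es. [:- e, 1:])"
    by (metis mult_cancel_left pCons_eq_0_iff zero_neq_one)
  from Cons.IH[OF C C_adj this] obtain U
    where U: "unitary_mat m U" and dU: "mat_adjoint U * C * U = mat_diag m (\<lambda>i. es ! i)"
    by blast
  note u = unitary_matD[OF U]
  define X where "X = ?F (1\<^sub>m 1) U"
  have X: "unitary_mat n X"
    unfolding X_def nm by (rule unitary_mat_four_block[OF U])
  note x = unitary_matD[OF X]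
  have "mat_adjoint (W * X) * A * (W * X) = mat_adjoint X * B * X"
    using A w(1,2) x(1,2)
    by (simp add: B_def mat_adjoint_mult[of _ n n _ n] assoc_mult_mat[of _ n n _ n _ n]
        mult_carrier_mat[of _ n n _ n])
  also have "mat_adjoint X = ?F (1\<^sub>m 1) (mat_adjoint U)"
    unfolding X_def using u by (simp add: mat_adjoint_four_block_diag)
  also have "\<dots> * B = ?F ?e (mat_adjoint U * C)"
    unfolding B_block using u(1,2) C
    by (subst mult_four_block_mat[of _ 1 1 _ m _ m _ _ 1 _ m]) auto
  also have "\<dots> * X = ?F ?e (mat_adjoint U * C * U)"
    unfolding X_def using u(1,2) C
    by (subst mult_four_block_mat[of _ 1 1 _ m _ m _ _ 1 _ m]) auto
  also have "\<dots> = mat_diag n (\<lambda>i. (e # es) ! i)"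
    unfolding dU by (rule eq_matI) (auto simp: mat_diag_def nm nth_Cons')
  finally show ?case
    using unitary_mat_mult[OF W X] by blast
qed

text \<open>Over the complex numbers the characteristic polynomial is monic and splits, so any
  listing of its root multiset can serve as the diagonal.\<close>

lemma hermitian_unitary_diag_proots:
  fixes A :: "complex mat"
  assumes A: "A \<in> carrier_mat n n" and "mat_adjoint A = A"
  obtains U es where "unitary_mat n U" "mat_adjoint U * A * U = mat_diag n (\<lambda>i. es ! i)"
    "mset es = proots (char_poly A)" "length es = n"
proof -
  obtain es where es: "mset es = proots (char_poly A)"
    using ex_mset by blast
  have mon: "lead_coeff (char_poly A) = 1" "degree (char_poly A) = n"
    using degree_monic_char_poly[OF A] by auto
  have "char_poly A = (\<Prod>x\<in>#proots (char_poly A). [:- x, 1:])"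
    using complex_poly_decompose_multiset[of "char_poly A"] mon by simp
  also have "\<dots> = (\<Prod>e\<leftarrow>es. [:- e, 1:])"
    unfolding es[symmetric] by (metis mset_map prod_mset_prod_list)
  finally have "char_poly A = (\<Prod>e\<leftarrow>es. [:- e, 1:])" .
  moreover have "length es = n"
    using mon(2) by (metis es size_mset size_proots_complex)
  ultimately show ?thesis
    using that hermitian_unitary_diag[OF assms] es by blast
qed

subsection \<open>The trace norm under diagonal perturbations\<close>

lemma sum_mset_eq_sum_nth:
  fixes f :: "'a \<Rightarrow> 'b::comm_monoid_add"
  assumes "mset xs = M" "length xs = n"
  shows "(\<Sum>x\<in>#M. f x) = (\<Sum>i<n. f (xs ! i))"
proof -
  have "(\<Sum>x\<in>#M. f x) = sum_list (map f xs)"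
    unfolding assms(1)[symmetric] by (metis mset_map sum_mset_sum_list)
  also have "\<dots> = (\<Sum>i<n. f (xs ! i))"
    using assms(2) by (simp add: sum_list_sum_nth lessThan_atLeast0)
  finally show ?thesis .
qed

text \<open>With \<open>M = mat_adjoint W * U\<close> the diagonal entries are \<open>\<Sum>k. a k * (cmod (M $$ (i, k)))\<^sup>2\<close>,
  and the columns of \<open>M\<close> are unit vectors.\<close>

lemma sum_cmod_diag_le:
  assumes A: "A \<in> carrier_mat n n" and U: "unitary_mat n U" and W: "unitary_mat n W"
    and dU: "mat_adjoint U * A * U = mat_diag n a"
  shows "(\<Sum>i<n. cmod ((mat_adjoint W * A * W) $$ (i, i))) \<le> (\<Sum>k<n. cmod (a k))"
proof -
  note u = unitary_matD[OF U] and w = unitary_matD[OF W]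
  define M where "M = mat_adjoint W * U"
  have "unitary_mat n M"
    unfolding M_def by (intro unitary_mat_mult unitary_mat_adjoint U W)
  note m = unitary_matD[OF this]
  \<comment> \<open>Writing \<open>mat_diag n a\<close> as \<open>mat_adjoint U * A * U\<close>
    leaves \<open>A\<close> between two copies of \<open>U * mat_adjoint U\<close>, both equal to
    the identity.\<close>
  have "M * mat_diag n a * mat_adjoint M
      = mat_adjoint W * ((U * mat_adjoint U) * A * (U * mat_adjoint U)) * W"
    using A u(1,2) w(1,2)
    by (simp flip: dU add: M_def mat_adjoint_mult[of _ n n _ n] assoc_mult_mat[of _ n n _ n _ n]
        mult_carrier_mat[of _ n n _ n])
  then have eq: "mat_adjoint W * A * W = M * mat_diag n a * mat_adjoint M"
    using A u(4) by simp
  have entry: "(mat_adjoint W * A * W) $$ (i, i) = (\<Sum>k<n. a k * (cmod (M $$ (i, k)))\<^sup>2)"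
    if "i < n" for i
    unfolding eq mat_diag_mult_right[OF m(1)] using m(1) that
    by (simp add: scalar_prod_def of_real_cmod_square lessThan_atLeast0 mult_ac)
  have unit: "(\<Sum>i<n. (cmod (M $$ (i, k)))\<^sup>2) = 1" if k: "k < n" for k
  proof -
    have "complex_of_real (\<Sum>i<n. (cmod (M $$ (i, k)))\<^sup>2) = (mat_adjoint M * M) $$ (k, k)"
      using m(1) k by (simp add: scalar_prod_def of_real_cmod_square lessThan_atLeast0 mult.commute)
    also have "\<dots> = complex_of_real 1"
      using m(3) k by simp
    finally show ?thesis
      by (simp only: of_real_eq_iff)
  qed
  have "(\<Sum>i<n. cmod ((mat_adjoint W * A * W) $$ (i, i)))
      \<le> (\<Sum>i<n. \<Sum>k<n. cmod (a k) * (cmod (M $$ (i, k)))\<^sup>2)"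
    by (intro sum_mono) (auto simp: entry norm_mult norm_power intro!: sum_norm_le)
  also have "\<dots> = (\<Sum>k<n. cmod (a k) * (\<Sum>i<n. (cmod (M $$ (i, k)))\<^sup>2))"
    by (subst sum.swap) (simp add: sum_distrib_left)
  also have "\<dots> = (\<Sum>k<n. cmod (a k))"
    by (simp add: unit)
  finally show ?thesis .
qed

text \<open>In a unitary eigenbasis \<open>X\<close> of \<open>C\<close>, each
  \<open>cs ! i - t\<close> is the sum of the \<open>i\<close>-th diagonal entries of the conjugated
  shifted diagonal matrix \<open>D\<close> and of \<open>c\<close> times the conjugated
  \<open>A\<close>. The triangle inequality separates the two, and \<open>sum_cmod_diag_le\<close>
  bounds each sum by the eigenvalues of \<open>D\<close> and of \<open>A\<close>.\<close>

lemma sum_cmod_proots_diag_perturbation: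
  fixes A C :: "complex mat"
  assumes A: "A \<in> carrier_mat n n" "mat_adjoint A = A"
    and C: "C \<in> carrier_mat n n" "mat_adjoint C = C"
    and CA: "C = mat_diag n f + c \<cdot>\<^sub>m A" and c: "cmod c = 1"
  shows "(\<Sum>\<nu>\<in>#proots (char_poly C). cmod (\<nu> - t))
    \<le> (\<Sum>\<nu>\<in>#proots (char_poly A). cmod \<nu>) + (\<Sum>i<n. cmod (f i - t))"
proof -
  obtain U as where U: "unitary_mat n U" "mat_adjoint U * A * U = mat_diag n (\<lambda>i. as ! i)"
    and as: "mset as = proots (char_poly A)" "length as = n"
    using hermitian_unitary_diag_proots[OF A] .
  obtain X cs where X: "unitary_mat n X" and dX: "mat_adjoint X * C * X = mat_diag n (\<lambda>i. cs ! i)"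
    and cs: "mset cs = proots (char_poly C)" "length cs = n"
    using hermitian_unitary_diag_proots[OF C] .
  note x = unitary_matD[OF X]
  define D where "D = mat_diag n (\<lambda>i. f i - t)"
  have D: "D \<in> carrier_mat n n"
    by (simp add: D_def)
  have C_eq: "C = D + c \<cdot>\<^sub>m A + t \<cdot>\<^sub>m 1\<^sub>m n"
    unfolding CA D_def using A by (intro eq_matI) (auto simp: mat_diag_def)
  have "mat_adjoint X * C = mat_adjoint X * D + c \<cdot>\<^sub>m (mat_adjoint X * A) + t \<cdot>\<^sub>m mat_adjoint X"
    unfolding C_eq using D A(1) x(1,2)
    by (simp add: mult_add_distrib_mat[of _ n n _ n] mult_smult_distrib[of _ n n _ n]
        del: assoc_add_mat)
  then have "mat_adjoint X * C * X
      = (mat_adjoint X * D + c \<cdot>\<^sub>m (mat_adjoint X * A) + t \<cdot>\<^sub>m mat_adjoint X) * X"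
    by (rule arg_cong)
  also have "\<dots> = mat_adjoint X * D * X + c \<cdot>\<^sub>m (mat_adjoint X * A * X) + t \<cdot>\<^sub>m (mat_adjoint X * X)"
    using D A(1) x(1,2)
    by (simp add: add_mult_distrib_mat[of _ n n _ _ n] mult_smult_assoc_mat[of _ n n _ n]
        mult_carrier_mat[of _ n n _ n] del: assoc_add_mat)
  finally have eq: "mat_diag n (\<lambda>i. cs ! i)
      = mat_adjoint X * D * X + c \<cdot>\<^sub>m (mat_adjoint X * A * X) + t \<cdot>\<^sub>m 1\<^sub>m n"
    by (simp only: dX x(3))
  have "cs ! i - t = (mat_adjoint X * D * X) $$ (i, i) + c * (mat_adjoint X * A * X) $$ (i, i)"
    if i: "i < n" for i
  proof -
    have "cs ! i = (mat_adjoint X * D * X + c \<cdot>\<^sub>m (mat_adjoint X * A * X) + t \<cdot>\<^sub>m 1\<^sub>m n) $$ (i, i)"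
      unfolding eq[symmetric] using i by (simp add: mat_diag_def)
    also have "\<dots> = (mat_adjoint X * D * X) $$ (i, i) + c * (mat_adjoint X * A * X) $$ (i, i) + t"
      using i x(1) by (simp del: index_mult_mat(1))
    finally show ?thesis by simp
  qed
  then have "(\<Sum>\<nu>\<in>#proots (char_poly C). cmod (\<nu> - t))
      = (\<Sum>i<n. cmod ((mat_adjoint X * D * X) $$ (i, i) + c * (mat_adjoint X * A * X) $$ (i, i)))"
    unfolding sum_mset_eq_sum_nth[OF cs] by (intro sum.cong) auto
  also have "\<dots> \<le> (\<Sum>i<n. cmod ((mat_adjoint X * D * X) $$ (i, i)) + cmod ((mat_adjoint X * A * X) $$ (i, i)))"
    by (intro sum_mono order.trans[OF norm_triangle_ineq]) (simp add: norm_mult c)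
  \<comment> \<open>\<open>D\<close> is already diagonal, so the identity serves as its
    diagonalising unitary matrix.\<close>
  also have "\<dots> \<le> (\<Sum>i<n. cmod (f i - t)) + (\<Sum>i<n. cmod (as ! i))"
    unfolding sum.distrib
    by (intro add_mono sum_cmod_diag_le[OF D unitary_mat_one X] sum_cmod_diag_le[OF A(1) U(1) X U(2)])
      (simp add: D_def left_mult_one_mat[of _ n n] right_mult_one_mat[of _ n n])
  finally show ?thesis
    by (simp add: sum_mset_eq_sum_nth[OF as])
qed

text \<open>The form for real symmetric matrices, which become Hermitian over the complex numbers.
  The sign \<open>c\<close> lets one statement cover both \<open>CNL\<close> and
  \<open>CNSL\<close>.\<close>

lemma sum_cmod_eigenvalues_diag_perturbation:
  fixes A C :: "real mat" and r :: "nat \<Rightarrow> real"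
  assumes A: "A \<in> carrier_mat n n" and sym: "\<And>i j. i < n \<Longrightarrow> j < n \<Longrightarrow> A $$ (i, j) = A $$ (j, i)"
    and C: "C = mat_diag n r + c \<cdot>\<^sub>m A" and c: "\<bar>c\<bar> = 1"
  shows "(\<Sum>\<nu>\<in>#eigenvalue_mset C. cmod (\<nu> - complex_of_real t))
    \<le> (\<Sum>\<nu>\<in>#eigenvalue_mset A. cmod \<nu>) + (\<Sum>i<n. \<bar>r i - t\<bar>)"
proof -
  let ?c = "map_mat complex_of_real"
  have "(\<Sum>i<n. \<bar>r i - t\<bar>) = (\<Sum>i<n. cmod (complex_of_real (r i) - complex_of_real t))"
    by (simp flip: of_real_diff)
  moreover have "?c C = mat_diag n (\<lambda>i. complex_of_real (r i)) + complex_of_real c \<cdot>\<^sub>m ?c A"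
    unfolding C using A by (intro eq_matI) (auto simp: mat_diag_def)
  moreover have "mat_adjoint (?c A) = ?c A"
    using A sym by (intro eq_matI) auto
  moreover have "mat_adjoint (?c C) = ?c C"
    unfolding C using A sym by (intro eq_matI) (auto simp: mat_diag_def)
  ultimately show ?thesis
    unfolding eigenvalue_mset_def
    using sum_cmod_proots_diag_perturbation[of "?c A" n "?c C" "\<lambda>i. complex_of_real (r i)" "complex_of_real c"
        "complex_of_real t"] A C c
    by simp
qed

subsection \<open>Row sums of the common neighbourhood matrix\<close>

lemma nbhd_subset: "finite_simple_graph V E \<Longrightarrow> nbhd E v \<subseteq> V"
  by (auto simp: finite_simple_graph_def nbhd_def)

lemma mem_nbhd_sym: "u \<in> nbhd E v \<longleftrightarrow> v \<in> nbhd E u"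
  by (simp add: nbhd_def insert_commute)

text \<open>Each neighbour \<open>u\<close> of \<open>v\<close> corresponds to the edge
  \<open>{u, v}\<close>. Every edge at \<open>v\<close> arises in this way because it has exactly
  two elements.\<close>

lemma degree_of_eq_card_incident:
  assumes "finite_simple_graph V E"
  shows "degree_of E v = card {e \<in> E. v \<in> e}"
proof -
  have "bij_betw (\<lambda>u. {u, v}) (nbhd E v) {e \<in> E. v \<in> e}"
    unfolding bij_betw_def
  proof
    show "inj_on (\<lambda>u. {u, v}) (nbhd E v)"
      by (auto simp: inj_on_def doubleton_eq_iff)
    have "e \<in> (\<lambda>u. {u, v}) ` nbhd E v" if e: "e \<in> E" "v \<in> e" for e
    proof -
      have "card e = 2"
        using assms e by (simp add: finite_simple_graph_def)
      then obtain u where "e = {u, v}"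
        using e(2) by (auto simp: card_2_iff)
      then show ?thesis
        using e by (auto simp: nbhd_def)
    qed
    then show "(\<lambda>u. {u, v}) ` nbhd E v = {e \<in> E. v \<in> e}"
      by (auto simp: nbhd_def)
  qed
  then show ?thesis
    by (simp add: degree_of_def bij_betw_same_card)
qed

text \<open>The handshake lemma, by counting incident pairs of a vertex and an edge in both
  orders.\<close>

lemma sum_degree_of:
  assumes G: "finite_simple_graph V E"
  shows "(\<Sum>v\<in>V. degree_of E v) = 2 * card E"
proof -
  have V: "finite V" and E: "finite E"
    using G by (auto simp: finite_simple_graph_def intro: finite_subset[of E "Pow V"])
  have "(\<Sum>v\<in>V. degree_of E v) = (\<Sum>v\<in>V. \<Sum>e\<in>E. if v \<in> e then 1 else 0)"
    using E by (simp add: degree_of_eq_card_incident[OF G] sum.If_cases Int_def)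
  also have "\<dots> = (\<Sum>e\<in>E. card {v \<in> V. v \<in> e})"
    using V by (subst sum.swap) (simp add: sum.If_cases Int_def)
  also have "\<dots> = (\<Sum>e\<in>E. 2)"
  proof (rule sum.cong)
    fix e assume "e \<in> E"
    then have "{v \<in> V. v \<in> e} = e" "card e = 2"
      using G by (auto simp: finite_simple_graph_def)
    then show "card {v \<in> V. v \<in> e} = 2" by simp
  qed simp
  finally show ?thesis by simp
qed

text \<open>Both sides count the triples \<open>u\<close>, \<open>v\<close>, \<open>w\<close> in
  which \<open>u\<close> and \<open>v\<close> are neighbours of \<open>w\<close>, with
  \<open>u = v\<close> allowed: each \<open>w\<close> admits the square of its degree many
  pairs.\<close>

lemma sum_card_common_nbhd:
  assumes G: "finite_simple_graph V E"
  shows "(\<Sum>u\<in>V. \<Sum>v\<in>V. card (nbhd E u \<inter> nbhd E v)) = first_zagreb V E"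
proof -
  have V: "finite V"
    using G by (simp add: finite_simple_graph_def)
  \<comment> \<open>A product of indicators, so that for fixed \<open>w\<close> the double sum over
    \<open>u\<close> and \<open>v\<close> factors.\<close>
  have card_eq: "card (nbhd E u \<inter> nbhd E v)
      = (\<Sum>w\<in>V. (if u \<in> nbhd E w then 1 else 0) * (if v \<in> nbhd E w then 1 else 0))" for u v
  proof -
    have "nbhd E u \<inter> nbhd E v = {w \<in> V. u \<in> nbhd E w \<and> v \<in> nbhd E w}"
      using nbhd_subset[OF G] by (auto simp: mem_nbhd_sym[of _ E u] mem_nbhd_sym[of _ E v])
    then have "card (nbhd E u \<inter> nbhd E v) = (\<Sum>w\<in>V. if u \<in> nbhd E w \<and> v \<in> nbhd E w then 1 else 0)"
      using V by (simp add: sum.If_cases Int_def)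
    also have "\<dots> = (\<Sum>w\<in>V. (if u \<in> nbhd E w then 1 else 0) * (if v \<in> nbhd E w then 1 else 0))"
      by (rule sum.cong) auto
    finally show ?thesis .
  qed
  have deg: "(\<Sum>u\<in>V. if u \<in> nbhd E w then 1 else 0) = degree_of E w" for w
    using V nbhd_subset[OF G, of w] by (simp add: degree_of_def sum.If_cases Int_absorb1)
  have "(\<Sum>u\<in>V. \<Sum>v\<in>V. card (nbhd E u \<inter> nbhd E v))
      = (\<Sum>u\<in>V. \<Sum>w\<in>V. \<Sum>v\<in>V. (if u \<in> nbhd E w then 1 else 0) * (if v \<in> nbhd E w then 1 else 0))"
    unfolding card_eq by (intro sum.cong refl sum.swap)
  also have "\<dots> = (\<Sum>w\<in>V. (\<Sum>u\<in>V. if u \<in> nbhd E w then 1 else 0) * (\<Sum>v\<in>V. if v \<in> nbhd E w then 1 else 0))"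
    unfolding sum_product by (rule sum.swap)
  also have "\<dots> = first_zagreb V E"
    unfolding deg by (simp add: first_zagreb_def power2_eq_square)
  finally show ?thesis .
qed

text \<open>The zero diagonal of \<open>CN\<close> removes the pairs \<open>u = v\<close> from the
  count of \<open>sum_card_common_nbhd\<close>. Such a pair contributes the degree of
  \<open>u\<close>, and the degrees add up to twice the number of edges.\<close>

lemma sum_CN_entries:
  assumes G: "finite_simple_graph V E" and vs: "distinct vs" "set vs = V"
  shows "(\<Sum>i<length vs. \<Sum>j<length vs. CN E vs $$ (i, j))
    = real (first_zagreb V E) - 2 * real (card E)"
proof -
  have reindex: "(\<Sum>i<length vs. g (vs ! i)) = (\<Sum>v\<in>V. g v)" for g :: "'a \<Rightarrow> real"
    using bij_betw_nth[OF vs(1) refl vs(2)[symmetric]] by (rule sum.reindex_bij_betw)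
  let ?g = "\<lambda>u v. real (card (nbhd E u \<inter> nbhd E v))"
  have "(\<Sum>j<length vs. CN E vs $$ (i, j)) = (\<Sum>v\<in>V. ?g (vs ! i) v) - real (degree_of E (vs ! i))"
    if i: "i < length vs" for i
  proof -
    have "(\<Sum>j<length vs. CN E vs $$ (i, j))
        = (\<Sum>j<length vs. ?g (vs ! i) (vs ! j) - (if j = i then real (degree_of E (vs ! i)) else 0))"
      using i by (intro sum.cong) (auto simp: CN_def degree_of_def)
    then show ?thesis
      using i by (simp add: sum_subtractf reindex[of "?g (vs ! i)"])
  qed
  then have "(\<Sum>i<length vs. \<Sum>j<length vs. CN E vs $$ (i, j))
      = (\<Sum>i<length vs. (\<lambda>u. (\<Sum>v\<in>V. ?g u v) - real (degree_of E u)) (vs ! i))"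
    by simp
  also have "\<dots> = (\<Sum>u\<in>V. (\<Sum>v\<in>V. ?g u v) - real (degree_of E u))"
    by (rule reindex)
  also have "\<dots> = real (\<Sum>u\<in>V. \<Sum>v\<in>V. card (nbhd E u \<inter> nbhd E v)) - real (\<Sum>u\<in>V. degree_of E u)"
    by (simp add: sum_subtractf)
  finally show ?thesis
    by (simp only: sum_card_common_nbhd[OF G] sum_degree_of[OF G] of_nat_mult of_nat_numeral)
qed

text \<open>For nonnegative numbers, the deviation from the mean is at most the number plus the
  mean, and the means add up to the total once more.\<close>

lemma sum_abs_deviation_le:
  fixes r :: "nat \<Rightarrow> real"
  assumes "\<And>i. i < n \<Longrightarrow> 0 \<le> r i"
  shows "(\<Sum>i<n. \<bar>r i - (\<Sum>i<n. r i) / real n\<bar>) \<le> 2 * (\<Sum>i<n. r i)"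
proof -
  let ?t = "(\<Sum>i<n. r i) / real n"
  have "0 \<le> ?t"
    using assms by (auto intro!: divide_nonneg_nonneg sum_nonneg)
  then have "(\<Sum>i<n. \<bar>r i - ?t\<bar>) \<le> (\<Sum>i<n. r i + ?t)"
    using assms by (intro sum_mono) (auto simp: abs_le_iff add_increasing)
  then show ?thesis
    \<comment> \<open>For \<open>n = 0\<close> both sums are empty; otherwise the \<open>n\<close>
      copies of \<open>?t\<close> cancel the division by \<open>n\<close>.\<close>
    by (cases "n = 0") (auto simp: sum.distrib)
qed

theorem theorem4p5:
  fixes V :: "'a set" and E :: "'a set set" and vs :: "'a list"
  assumes "finite_simple_graph V E"
    and "distinct vs" and "set vs = V"
  shows "LE_CN E vs \<le> E_CN E vs + 2 * (real (first_zagreb V E) - 2 * real (card E)) \<and>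
         LE_CN_plus E vs \<le> E_CN E vs + 2 * (real (first_zagreb V E) - 2 * real (card E))"
proof -
  define n where "n = length vs"
  define r where "r i = (\<Sum>j<n. CN E vs $$ (i, j))" for i
  have A: "CN E vs \<in> carrier_mat n n"
    by (simp add: CN_def n_def)
  have R: "CNRS E vs = mat_diag n r"
    by (simp add: CNRS_def n_def r_def[abs_def])
  have sym: "CN E vs $$ (i, j) = CN E vs $$ (j, i)" if "i < n" "j < n" for i j
    using that by (simp add: CN_def n_def Int_commute)
  have "0 \<le> r i" if "i < n" for i
    using that by (auto simp: r_def CN_def n_def intro!: sum_nonneg)
  then have dev: "(\<Sum>i<n. \<bar>r i - (\<Sum>i<n. r i) / real n\<bar>)
      \<le> 2 * (real (first_zagreb V E) - 2 * real (card E))"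
    using sum_abs_deviation_le[of n r] sum_CN_entries[OF assms] by (simp add: r_def n_def)
  \<comment> \<open>The trace is the total of the row sums, so the shift in both Laplacian energies
    is the mean used in \<open>dev\<close>.\<close>
  have "mat_tr (CNRS E vs) = (\<Sum>i<n. r i)"
    by (simp add: R mat_tr_def diag_mat_def mat_diag_def sum_list_sum_nth lessThan_atLeast0)
  then have tr: "mat_tr (CNRS E vs) / real (length vs) = (\<Sum>i<n. r i) / real n"
    by (simp add: n_def)
  \<comment> \<open>The two energies are the cases \<open>c = -1\<close> and \<open>c = 1\<close> of
    the perturbation bound.\<close>
  have minus: "CNL E vs = mat_diag n r + (-1) \<cdot>\<^sub>m CN E vs"
    unfolding CNL_def R using A by (intro eq_matI) auto
  have plus: "CNSL E vs = mat_diag n r + 1 \<cdot>\<^sub>m CN E vs"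
    unfolding CNSL_def R using A by (intro eq_matI) auto
  let ?t = "(\<Sum>i<n. r i) / real n"
  show ?thesis
    using dev sum_cmod_eigenvalues_diag_perturbation[OF A _ minus, of ?t]
      sum_cmod_eigenvalues_diag_perturbation[OF A _ plus, of ?t] sym
    unfolding LE_CN_def LE_CN_plus_def E_CN_def tr by simp
qed

end
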